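(* For any positive integer $n$ and any integer $g \geq \frac{2}{3}n$, we have $PG(n,g) = p(n-g)$.
   Context: A partition $\lambda=(\lambda_1\ge\lambda_2\ge\cdots\ge\lambda_\ell)$ of a positive integer $n$ is a finite nonincreasing sequence of positive integers with sum $n$; $\ell(\lambda)$ is its number of parts, and $p(N)$ denotes the number of partitions of $N$ (with $p(0)=1$). For a cell $(i,j)$ of the Ferrers diagram of $\lambda$, the hook length $h_{(i,j)}(\lambda)$ is the number of cells consisting of the cell itself, the cells to its right in row $i$, and the cells below it in column $j$. A numerical set is a subset $S\subseteq\mathbb{N}_0=\{0,1,2,\dots\}$ containing $0$ with finite complement; it is a numerical semigroup if it is also closed under addition. To a partition $\lambda$ associate the numerical set $S_\lambda=\mathbb{N}_0\setminus\{h_{(i,1)}(\lambda): 1\le i\le \ell(\lambda)\}$ (the gaps of $S_\lambda$ are the hook lengths of the first column). $PG(n,g)$ denotes the number of partitions $\lambda$ of $n$ with exactly $g$ parts such that $S_\lambda$ is a numerical semigroup. *)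

theory Defs
  imports Complex_Main
begin

(* The empty list is the partition of 0. *)
definition is_partition :: "nat list \<Rightarrow> bool" where
  "is_partition l \<longleftrightarrow> sorted_wrt (\<ge>) l \<and> (\<forall>x\<in>set l. 0 < x)"

(* The argument is an integer so that a negative number has no partitions;
   with truncated subtraction on nat, p(n - g) would be 1 for g > n. *)
definition num_partitions :: "int \<Rightarrow> nat" where
  "num_partitions N = card {l. is_partition l \<and> int (sum_list l) = N}"

(* Rows and columns are numbered from 1. *)
definition ferrers :: "nat list \<Rightarrow> (nat \<times> nat) set" where
  "ferrers l = {(i, j). 1 \<le> i \<and> i \<le> length l \<and> 1 \<le> j \<and> j \<le> l ! (i - 1)}"

definition hook :: "nat list \<Rightarrow> nat \<times> nat \<Rightarrow> (nat \<times> nat) set" where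
  "hook l c = {(i, j) \<in> ferrers l.
     (i = fst c \<and> snd c \<le> j) \<or> (j = snd c \<and> fst c \<le> i)}"

definition hook_length :: "nat list \<Rightarrow> nat \<times> nat \<Rightarrow> nat" where
  "hook_length l c = card (hook l c)"

definition numerical_set :: "nat set \<Rightarrow> bool" where
  "numerical_set S \<longleftrightarrow> 0 \<in> S \<and> finite (- S)"

definition numerical_semigroup :: "nat set \<Rightarrow> bool" where
  "numerical_semigroup S \<longleftrightarrow> numerical_set S \<and> (\<forall>a\<in>S. \<forall>b\<in>S. a + b \<in> S)"

definition S_of :: "nat list \<Rightarrow> nat set" where
  "S_of l = UNIV - {hook_length l (i, 1) | i. 1 \<le> i \<and> i \<le> length l}"

definition PG :: "nat \<Rightarrow> int \<Rightarrow> nat" where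
  "PG n g = card {l. is_partition l \<and> sum_list l = n \<and> int (length l) = g \<and>
                     numerical_semigroup (S_of l)}"

end

theory Submission
  imports Defs
begin

text \<open>
  Deleting the first column of the Ferrers diagram identifies the partitions of \<open>n\<close> with \<open>g\<close> parts
  with the partitions of \<open>k = n - g\<close> that have at most \<open>g\<close> parts, and the hypothesis says \<open>2k \<le> g\<close>, so
  the bound on the number of parts is vacuous. The semigroup condition is vacuous as well. Let \<open>a \<le> b\<close>
  be positive nongaps with \<open>a + b\<close> a gap, so that \<open>a + b \<le> \<lambda>\<^sub>1 + g - 1\<close>, the largest gap; since
  \<open>\<lambda>\<^sub>1 - 1 \<le> k\<close>, this forces \<open>a \<le> g\<close>. The hook length in row \<open>g + 1 - a\<close> is not \<open>a\<close>, so the first \<open>g + 1 - a\<close> parts are at least 2 and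
  \<open>k \<ge> (\<lambda>\<^sub>1 - 1) + (g - a)\<close>; doubling and using \<open>2a \<le> \<lambda>\<^sub>1 + g - 1\<close> gives \<open>2k \<ge> \<lambda>\<^sub>1 - 1 + g > g\<close>.
\<close>

lemma is_partition_Cons:
  "is_partition (x # xs) \<longleftrightarrow> 0 < x \<and> (\<forall>y\<in>set xs. y \<le> x) \<and> is_partition xs"
  by (auto simp: is_partition_def)

lemma is_partition_nth_mono:
  assumes "is_partition l" "i \<le> j" "j < length l"
  shows "l ! j \<le> l ! i"
proof (cases "i = j")
  case False
  then show ?thesis
    using assms by (auto simp: is_partition_def sorted_wrt_iff_nth_less)
qed simp

lemma is_partition_nth_pos:
  assumes "is_partition l" "i < length l"
  shows "0 < l ! i"
  using assms by (simp add: is_partition_def)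

lemma length_le_sum_list:
  assumes "is_partition l"
  shows "length l \<le> sum_list l"
  using assms by (induction l) (auto simp: is_partition_Cons)

text \<open>Rows \<open>0\<close> to \<open>j\<close> have at least two cells each, so the first two
  columns already contain \<open>length l + Suc j\<close> cells.\<close>

lemma length_add_le_sum_list:
  assumes "is_partition l" "j < length l" "2 \<le> l ! j"
  shows "length l + Suc j \<le> sum_list l"
  using assms
proof (induction l arbitrary: j)
  case (Cons x xs)
  have xs: "is_partition xs" and le: "\<forall>y\<in>set xs. y \<le> x"
    using Cons.prems by (auto simp: is_partition_Cons)
  show ?case
  proof (cases j)
    case 0
    then show ?thesis using Cons.prems length_le_sum_list[OF xs] by simp
  next
    case (Suc i)
    then have i: "i < length xs" "2 \<le> xs ! i" using Cons.prems by auto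
    then have "2 \<le> x" using le nth_mem[OF i(1)] by fastforce
    then show ?thesis using Cons.IH[OF xs i] Suc by simp
  qed
qed simp

text \<open>Counts the whole first row, the \<open>length l - 1\<close> cells below it in the first
  column, and \<open>j\<close> more cells in the second column.\<close>

lemma hd_length_add_le_sum_list:
  assumes "is_partition l" "j < length l" "2 \<le> l ! j"
  shows "l ! 0 + length l + j \<le> Suc (sum_list l)"
proof (cases l)
  case (Cons x xs)
  then have xs: "is_partition xs" using assms by (simp add: is_partition_Cons)
  show ?thesis
  proof (cases j)
    case 0
    then show ?thesis using Cons length_le_sum_list[OF xs] by simp
  next
    case (Suc i)
    then show ?thesis using Cons assms length_add_le_sum_list[OF xs, of i] by simp
  qed
qed (use assms in simp)

text \<open>All parts are positive, so the leg runs down to the last row. List index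
  \<open>i\<close> is row \<open>Suc i\<close> of the diagram.\<close>

lemma hook_length_first_column:
  assumes "is_partition l" "i < length l"
  shows "hook_length l (Suc i, 1) = l ! i + (length l - Suc i)"
proof -
  have "hook l (Suc i, 1) = {Suc i} \<times> {1..l ! i} \<union> {Suc (Suc i)..length l} \<times> {1}"
  proof (intro set_eqI iffI)
    fix c assume "c \<in> {Suc i} \<times> {1..l ! i} \<union> {Suc (Suc i)..length l} \<times> {1}"
    moreover have "1 \<le> l ! (r - 1)" if "1 \<le> r" "r \<le> length l" for r
      using is_partition_nth_pos[OF assms(1), of "r - 1"] that by (simp add: Suc_le_eq)
    ultimately show "c \<in> hook l (Suc i, 1)"
      using assms(2) by (auto simp: hook_def ferrers_def)
  next
    fix c assume "c \<in> hook l (Suc i, 1)"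
    then show "c \<in> {Suc i} \<times> {1..l ! i} \<union> {Suc (Suc i)..length l} \<times> {1}"
      by (cases c) (auto simp: hook_def ferrers_def not_less_eq_eq le_Suc_eq)
  qed
  moreover have "card ({Suc i} \<times> {1..l ! i} \<union> {Suc (Suc i)..length l} \<times> {1 :: nat})
      = l ! i + (length l - Suc i)"
    by (subst card_Un_disjoint) (auto simp: card_cartesian_product)
  ultimately show ?thesis by (simp add: hook_length_def)
qed

lemma S_of_eq:
  assumes "is_partition l"
  shows "S_of l = - ((\<lambda>i. l ! i + (length l - Suc i)) ` {..<length l})"
proof -
  have "{hook_length l (i, 1) | i. 1 \<le> i \<and> i \<le> length l}
      = (\<lambda>i. hook_length l (i, 1)) ` Suc ` {..<length l}"
    by (auto simp: image_Suc_lessThan)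
  also have "\<dots> = (\<lambda>i. l ! i + (length l - Suc i)) ` {..<length l}"
    unfolding image_image
    by (rule image_cong) (use hook_length_first_column[OF assms] in auto)
  finally show ?thesis by (simp add: S_of_def Compl_eq_Diff_UNIV)
qed

text \<open>A part 1 at index \<open>length l - a\<close> has \<open>a - 1\<close> rows below it, so
  its first-column hook length would be \<open>a\<close>, making \<open>a\<close> a gap.\<close>

lemma nth_ge_2_of_mem_S_of:
  assumes "is_partition l" "a \<in> S_of l" "0 < a" "a \<le> length l"
  shows "2 \<le> l ! (length l - a)"
proof -
  have i: "length l - a < length l" using assms by simp
  then have "a \<noteq> l ! (length l - a) + (length l - Suc (length l - a))"
    using assms(2) i unfolding S_of_eq[OF assms(1)] by blast
  then show ?thesis
    using is_partition_nth_pos[OF assms(1) i] assms by linarith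
qed

lemma numerical_semigroup_S_of:
  assumes part: "is_partition l" and large: "2 * sum_list l \<le> 3 * length l"
  shows "numerical_semigroup (S_of l)"
proof -
  let ?g = "length l"
  have no_gap: "a + b \<in> S_of l"
    if ab: "a \<in> S_of l" "0 < a" "a \<le> b" for a b
  proof (rule ccontr)
    assume "a + b \<notin> S_of l"
    then obtain i where i: "i < ?g" "a + b = l ! i + (?g - Suc i)"
      using part by (auto simp: S_of_eq)
    have bound: "a + b + 1 \<le> l ! 0 + ?g"
      using is_partition_nth_mono[OF part, of 0 i] i by simp
    show False
    proof (cases "a \<le> ?g")
      case True
      have two: "2 \<le> l ! (?g - a)"
        using nth_ge_2_of_mem_S_of[OF part ab(1,2) True] .
      have lt: "?g - a < ?g" using True ab by simp
      have "2 \<le> l ! 0" using two is_partition_nth_mono[OF part, of 0 "?g - a"] lt by simp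
      \<comment> \<open>The count with \<open>j = ?g - a\<close>, doubled and combined with
        \<open>bound\<close>, \<open>large\<close> and \<open>2 * a \<le> a + b\<close>, yields
        \<open>l ! 0 \<le> 1\<close>.\<close>
      then show False
        using hd_length_add_le_sum_list[OF part lt two] bound ab True large by linarith
    next
      case False
      \<comment> \<open>Both summands exceed \<open>?g\<close>, so \<open>bound\<close> and the
        count with \<open>j = 0\<close> make the sum at least \<open>2 * ?g + 2\<close>, against
        \<open>large\<close>.\<close>
      then have "2 \<le> l ! 0" using bound ab by simp
      then have "l ! 0 + ?g \<le> Suc (sum_list l)"
        using hd_length_add_le_sum_list[OF part, of 0] i(1) by fastforce
      then show False using False bound ab large by linarith
    qed
  qed
  have "a + b \<in> S_of l" if "a \<in> S_of l" "b \<in> S_of l" for a b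
    using that no_gap[of a b] no_gap[of b a]
    by (cases "a = 0"; cases "b = 0"; cases "a \<le> b") (auto simp: add.commute)
  moreover have "0 \<in> S_of l"
    using is_partition_nth_pos[OF part] by (fastforce simp: S_of_eq[OF part])
  moreover have "finite (- S_of l)" by (simp add: S_of_eq[OF part])
  ultimately show ?thesis by (simp add: numerical_semigroup_def numerical_set_def)
qed

text \<open>The padding ones are cells of the new column beside empty rows. Its height is
  \<open>g\<close> only if \<open>length m \<le> g\<close>; otherwise the truncated subtraction
  gives no padding.\<close>

definition add_column :: "nat \<Rightarrow> nat list \<Rightarrow> nat list" where
  "add_column g m = map Suc m @ replicate (g - length m) 1"

definition remove_column :: "nat list \<Rightarrow> nat list" where
  "remove_column l = filter (\<lambda>x. 0 < x) (map (\<lambda>x. x - 1) l)"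

lemma length_remove_column_le: "length (remove_column l) \<le> length l"
  unfolding remove_column_def by (metis length_filter_le length_map)

lemma remove_add_column:
  assumes "is_partition m"
  shows "remove_column (add_column g m) = m"
  using assms
  by (auto simp: remove_column_def add_column_def is_partition_def comp_def filter_id_conv)

text \<open>The rows lost are the parts equal to 1, which stand at the end of \<open>l\<close>;
  \<open>length l\<close> records how many to restore.\<close>

lemma add_remove_column:
  assumes "is_partition l"
  shows "add_column (length l) (remove_column l) = l"
  using assms
proof (induction l)
  case (Cons x xs)
  then have IH: "add_column (length xs) (remove_column xs) = xs"
    and x: "0 < x" and le: "\<forall>y\<in>set xs. y \<le> x" and pos: "\<forall>y\<in>set xs. 0 < y"
    by (auto simp: is_partition_def)
  show ?case
  proof (cases "x = 1")
    case True
    then have "\<forall>y\<in>set xs. y = 1" using le pos by (metis One_nat_def Suc_leI le_antisym)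
    then show ?thesis using True
      by (auto simp: add_column_def remove_column_def filter_empty_conv replicate_length_same
          cong: filter_cong)
  next
    case False
    then show ?thesis using x IH by (simp add: add_column_def remove_column_def)
  qed
qed (simp add: add_column_def remove_column_def)

lemma is_partition_add_column:
  assumes "is_partition m"
  shows "is_partition (add_column g m)"
proof -
  have "sorted_wrt (\<ge>) (replicate r (1 :: nat))" for r by (induction r) auto
  then show ?thesis
    using assms by (auto simp: is_partition_def add_column_def sorted_wrt_append sorted_wrt_map)
qed

lemma is_partition_remove_column:
  assumes "is_partition l"
  shows "is_partition (remove_column l)"
  using assms unfolding is_partition_def remove_column_def
  by (auto simp: sorted_wrt_map intro!: sorted_wrt_filter elim!: sorted_wrt_mono_rel[rotated])

lemma length_add_column:
  assumes "length m \<le> g"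
  shows "length (add_column g m) = g"
  using assms by (simp add: add_column_def)

lemma sum_list_add_column:
  assumes "length m \<le> g"
  shows "sum_list (add_column g m) = sum_list m + g"
proof -
  have "sum_list (map Suc m) = sum_list m + length m" by (induction m) auto
  then show ?thesis using assms by (simp add: add_column_def sum_list_replicate)
qed

lemma card_partitions_of_length:
  assumes "k \<le> g"
  shows "card {l. is_partition l \<and> sum_list l = k + g \<and> length l = g}
    = card {m. is_partition m \<and> sum_list m = k}"
proof (rule bij_betw_same_card[of remove_column])
  show "bij_betw remove_column {l. is_partition l \<and> sum_list l = k + g \<and> length l = g}
    {m. is_partition m \<and> sum_list m = k}"
  proof (rule bij_betw_byWitness[where f' = "add_column g"])
    show "remove_column ` {l. is_partition l \<and> sum_list l = k + g \<and> length l = g}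
        \<subseteq> {m. is_partition m \<and> sum_list m = k}"
    proof clarify
      fix l assume l: "is_partition l" "sum_list l = k + length l" "g = length l"
      then show "is_partition (remove_column l) \<and> sum_list (remove_column l) = k"
        using sum_list_add_column[OF length_remove_column_le, of l] add_remove_column[of l]
          is_partition_remove_column[of l] by simp
    qed
    \<comment> \<open>A partition of \<open>k\<close> has at most \<open>k \<le> g\<close> parts, so
      the new column has height exactly \<open>g\<close>.\<close>
    show "add_column g ` {m. is_partition m \<and> sum_list m = k}
        \<subseteq> {l. is_partition l \<and> sum_list l = k + g \<and> length l = g}"
      using assms length_le_sum_list
      by (fastforce simp: is_partition_add_column length_add_column sum_list_add_column)
  qed (auto simp: remove_add_column add_remove_column)
qed

theorem theorem3p1:
  fixes n :: nat and g :: int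
  assumes "n > 0"
    and "real_of_int g \<ge> 2 / 3 * real n"
  shows "PG n g = num_partitions (int n - g)"
proof -
  have "real_of_int (2 * int n) \<le> real_of_int (3 * g)" using assms(2) by simp
  then have g3: "2 * int n \<le> 3 * g" by (simp only: of_int_le_iff)
  define G where "G = nat g"
  have G: "g = int G" using g3 by (simp add: G_def)
  have PG: "PG n g = card {l. is_partition l \<and> sum_list l = n \<and> length l = G}"
    unfolding PG_def G
    by (rule arg_cong[where f = card]) (use g3 G numerical_semigroup_S_of in auto)
  show ?thesis
  proof (cases "G \<le> n")
    case True
    define k where "k = n - G"
    have n: "n = k + G" and k: "k \<le> G" using True g3 G by (auto simp: k_def)
    show ?thesis
      using card_partitions_of_length[OF k] unfolding PG by (simp add: num_partitions_def n G)
  next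
    case False
    \<comment> \<open>For \<open>g > n\<close> both sides vanish: there are too many parts on the
      left, and a negative argument on the right.\<close>
    then have "{l. is_partition l \<and> sum_list l = n \<and> length l = G} = {}"
      using length_le_sum_list by auto
    moreover have "{l. is_partition l \<and> int (sum_list l) = int n - g} = {}"
      using False G by auto
    ultimately show ?thesis by (simp only: PG num_partitions_def card.empty)
  qed
qed

end
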